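(* The correspondence $\alpha\mapsto\mu_\alpha$, defined on $AC$, is surjective onto the set of positive, finite Borel measures on $P^{d-1}$: for every positive finite Borel measure $\mu$ on $P^{d-1}$ there exists $\alpha\in AC$ with $\mu_\alpha=\mu$.
   Context: $AC$ is the space of absolutely continuous curves $\alpha:[0,1]\to\mathbb{R}^d$ modulo translation. $P^{d-1}$ is real projective space of dimension $d-1$, and $\pi:S^{d-1}\to P^{d-1}$ is the projection identifying antipodal points. For $f\in C(P^{d-1})$, $\hat f:\mathbb{R}^d\to\mathbb{R}$ denotes the degree $1$ homogeneous extension $\hat f(r\xi)=|r|\,f(\pi(\xi))$ for $r\in\mathbb{R}$, $\xi\in S^{d-1}$. For $\alpha\in AC$, $\mu_\alpha$ is the unique finite positive Borel measure on $P^{d-1}$ with $\int f\,d\mu_\alpha=\int_0^1\hat f(\alpha'(t))\,dt$ for all $f\in C(P^{d-1})$. *)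

theory Defs
  imports "HOL-Analysis.Analysis"
begin

definition antipodal_rel :: "'a::euclidean_space \<Rightarrow> 'a \<Rightarrow> bool" where
  "antipodal_rel x y \<longleftrightarrow> x \<in> sphere 0 1 \<and> y \<in> sphere 0 1 \<and> (x = y \<or> x = - y)"

lemma part_equivp_antipodal_rel: "part_equivp (antipodal_rel :: 'a::euclidean_space \<Rightarrow> _)"
proof (rule part_equivpI)
  obtain x :: 'a where "x \<in> Basis" using nonempty_Basis by blast
  then show "\<exists>x::'a. antipodal_rel x x"
    by (auto simp: antipodal_rel_def intro!: exI[of _ x])
qed (auto intro!: sympI transpI simp: antipodal_rel_def)

(* Real projective space of dimension DIM('a) - 1. The abstraction map sphere_proj is
   meaningful only on the unit sphere. *)
quotient_type (overloaded) 'a proj_space = "'a::euclidean_space" / partial: antipodal_rel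
  morphisms rep_proj_space sphere_proj
  by (rule part_equivp_antipodal_rel)

instantiation proj_space :: (euclidean_space) topological_space
begin

definition open_proj_space :: "'a proj_space set \<Rightarrow> bool" where
  "open_proj_space U \<longleftrightarrow>
     openin (top_of_set (sphere 0 1)) {x \<in> sphere 0 1. sphere_proj x \<in> U}"

instance
proof
  show "open (UNIV :: 'a proj_space set)"
    using openin_subtopology_self[of "sphere 0 1 :: 'a set"]
    by (simp add: open_proj_space_def sphere_def)
  fix S T :: "'a proj_space set"
  assume "open S" "open T"
  then have "openin (top_of_set (sphere 0 1))
      ({x \<in> sphere 0 1. sphere_proj x \<in> S} \<inter> {x \<in> sphere 0 1. sphere_proj x \<in> T})"
    unfolding open_proj_space_def by (rule openin_Int)
  moreover have "{x \<in> sphere 0 1. sphere_proj x \<in> S} \<inter> {x \<in> sphere 0 1. sphere_proj x \<in> T}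
      = {x \<in> sphere 0 1. sphere_proj x \<in> S \<inter> T}" by auto
  ultimately show "open (S \<inter> T)" by (simp add: open_proj_space_def)
next
  fix K :: "'a proj_space set set"
  assume "\<forall>S\<in>K. open S"
  then have "openin (top_of_set (sphere 0 1))
      (\<Union>S\<in>K. {x \<in> sphere 0 1. sphere_proj x \<in> S})"
    unfolding open_proj_space_def by (intro openin_Union) auto
  moreover have "(\<Union>S\<in>K. {x \<in> sphere 0 1. sphere_proj x \<in> S})
      = {x \<in> sphere 0 1. sphere_proj x \<in> \<Union>K}" by auto
  ultimately show "open (\<Union>K)" by (simp add: open_proj_space_def)
qed

end

lemma sphere_proj_eq_iff:
  assumes "x \<in> sphere 0 1" "y \<in> sphere 0 1"
  shows "sphere_proj x = sphere_proj y \<longleftrightarrow> x = y \<or> x = - y"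
proof -
  have "antipodal_rel x y \<longleftrightarrow> antipodal_rel x x \<and> antipodal_rel y y \<and> sphere_proj x = sphere_proj y"
    using Quotient_rel[OF Quotient_proj_space] by metis
  with assms show ?thesis by (auto simp: antipodal_rel_def)
qed

lemma sphere_proj_surj: "sphere_proj ` sphere 0 1 = (UNIV :: 'a::euclidean_space proj_space set)"
proof -
  have "\<exists>x\<in>sphere 0 1. sphere_proj x = p" for p :: "'a proj_space"
  proof -
    have "antipodal_rel (rep_proj_space p) (rep_proj_space p)"
      using Quotient_rep_reflp[OF Quotient_proj_space] .
    then show ?thesis
      using Quotient_abs_rep[OF Quotient_proj_space, of p] by (auto simp: antipodal_rel_def)
  qed
  then show ?thesis by (metis image_iff UNIV_eq_I)
qed

lemma quotient_map_sphere_proj: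
  "quotient_map (top_of_set (sphere 0 1)) (euclidean :: 'a::euclidean_space proj_space topology) sphere_proj"
  by (auto simp: quotient_map_def open_proj_space_def sphere_proj_surj)

definition hom_ext :: "('a::euclidean_space proj_space \<Rightarrow> real) \<Rightarrow> 'a \<Rightarrow> real" where
  "hom_ext f v = norm v * f (sphere_proj (sgn v))"

lemma hom_ext_scaleR:
  assumes "\<xi> \<in> sphere 0 1"
  shows "hom_ext f (r *\<^sub>R \<xi>) = \<bar>r\<bar> * f (sphere_proj \<xi>)"
proof -
  have \<xi>: "norm \<xi> = 1" "sgn \<xi> = \<xi>" using assms by (auto simp: sgn_div_norm)
  consider "r = 0" | "r > 0" | "r < 0" by linarith
  then show ?thesis
  proof cases
    case 3
    then have "sphere_proj (sgn (r *\<^sub>R \<xi>)) = sphere_proj \<xi>"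
      using assms \<xi> by (simp add: sgn_scaleR sphere_proj_eq_iff)
    then show ?thesis by (simp add: hom_ext_def \<xi>)
  qed (auto simp: hom_ext_def \<xi> sgn_scaleR)
qed

definition abs_continuous_on :: "real set \<Rightarrow> (real \<Rightarrow> 'a::metric_space) \<Rightarrow> bool" where
  "abs_continuous_on S \<alpha> \<longleftrightarrow>
    (\<forall>\<epsilon>>0. \<exists>\<delta>>0. \<forall>(n::nat) a b.
       (\<forall>i<n. a i \<le> b i \<and> {a i..b i} \<subseteq> S) \<and>
       disjoint_family_on (\<lambda>i. {a i<..<b i}) {..<n} \<and>
       (\<Sum>i<n. b i - a i) < \<delta> \<longrightarrow>
       (\<Sum>i<n. dist (\<alpha> (a i)) (\<alpha> (b i))) < \<epsilon>)"

(* Only the values of a curve on [0,1] matter. *)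
definition ac_rel :: "(real \<Rightarrow> 'a::euclidean_space) \<Rightarrow> (real \<Rightarrow> 'a) \<Rightarrow> bool" where
  "ac_rel \<alpha> \<beta> \<longleftrightarrow> abs_continuous_on {0..1} \<alpha> \<and> abs_continuous_on {0..1} \<beta> \<and>
     (\<exists>c. \<forall>t\<in>{0..1}. \<beta> t = \<alpha> t + c)"

lemma part_equivp_ac_rel: "part_equivp (ac_rel :: (real \<Rightarrow> 'a::euclidean_space) \<Rightarrow> _)"
proof (rule part_equivpI)
  have "abs_continuous_on {0..1} (\<lambda>_. 0 :: 'a)"
    by (auto simp: abs_continuous_on_def intro: exI[of _ 1])
  then show "\<exists>\<alpha>::real \<Rightarrow> 'a. ac_rel \<alpha> \<alpha>"
    by (auto simp: ac_rel_def intro!: exI[of _ "\<lambda>_. 0"])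
  show "symp (ac_rel :: (real \<Rightarrow> 'a) \<Rightarrow> _)"
  proof (rule sympI)
    fix \<alpha> \<beta> :: "real \<Rightarrow> 'a"
    assume *: "ac_rel \<alpha> \<beta>"
    then obtain c where "\<forall>t\<in>{0..1}. \<beta> t = \<alpha> t + c" by (auto simp: ac_rel_def)
    then have "\<forall>t\<in>{0..1}. \<alpha> t = \<beta> t + (- c)" by simp
    with * show "ac_rel \<beta> \<alpha>" unfolding ac_rel_def by blast
  qed
  show "transp (ac_rel :: (real \<Rightarrow> 'a) \<Rightarrow> _)"
  proof (rule transpI)
    fix \<alpha> \<beta> \<gamma> :: "real \<Rightarrow> 'a"
    assume *: "ac_rel \<alpha> \<beta>" "ac_rel \<beta> \<gamma>"
    then obtain c d where "\<forall>t\<in>{0..1}. \<beta> t = \<alpha> t + c" "\<forall>t\<in>{0..1}. \<gamma> t = \<beta> t + d"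
      unfolding ac_rel_def by blast
    then have "\<forall>t\<in>{0..1}. \<gamma> t = \<alpha> t + (c + d)" by (simp add: add.assoc)
    with * show "ac_rel \<alpha> \<gamma>" unfolding ac_rel_def by blast
  qed
qed

quotient_type (overloaded) 'a ac_curve = "real \<Rightarrow> 'a::euclidean_space" / partial: ac_rel
  by (rule part_equivp_ac_rel)

(* Taken within [0,1], so that it depends only on the curve on [0,1]; at the null set of points of
   non-differentiability its value is arbitrary. *)
definition curve_deriv :: "(real \<Rightarrow> 'a::euclidean_space) \<Rightarrow> real \<Rightarrow> 'a" where
  "curve_deriv \<alpha> t = vector_derivative \<alpha> (at t within {0..1})"

lemma curve_deriv_translate:
  assumes "\<forall>t\<in>{0..1}. \<beta> t = \<alpha> t + c" "t \<in> {0..1}"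
  shows "curve_deriv \<beta> t = curve_deriv \<alpha> t"
proof -
  have "(\<beta> has_vector_derivative D) (at t within {0..1}) \<longleftrightarrow>
        (\<alpha> has_vector_derivative D) (at t within {0..1})" for D
  proof -
    have "(\<beta> has_vector_derivative D) (at t within {0..1}) \<longleftrightarrow>
        ((\<lambda>t. \<alpha> t + c) has_vector_derivative D) (at t within {0..1})"
      using assms
        has_vector_derivative_transform[of t "{0..1}" \<beta> "\<lambda>t. \<alpha> t + c" D]
        has_vector_derivative_transform[of t "{0..1}" "\<lambda>t. \<alpha> t + c" \<beta> D]
      by metis
    also have "\<dots> \<longleftrightarrow> (\<alpha> has_vector_derivative D) (at t within {0..1})"
      using has_vector_derivative_add_const[of \<alpha> c D "at t within {0..1}"]
      by (simp add: add.commute)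
    finally show ?thesis .
  qed
  then show ?thesis by (simp add: curve_deriv_def vector_derivative_def)
qed

(* The completed measure lebesgue, rather than lborel, makes the arbitrary values of curve_deriv on a
   null set irrelevant to measurability as well. *)
definition represents_curve ::
    "'a::euclidean_space proj_space measure \<Rightarrow> (real \<Rightarrow> 'a) \<Rightarrow> bool" where
  "represents_curve M \<alpha> \<longleftrightarrow> sets M = sets borel \<and> finite_measure M \<and>
     (\<forall>f. continuous_on UNIV f \<longrightarrow>
       (LINT p|M. f p) = (LINT t:{0..1}|lebesgue. hom_ext f (curve_deriv \<alpha> t)))"

lift_definition curve_measure :: "'a::euclidean_space ac_curve \<Rightarrow> 'a proj_space measure"
  is "\<lambda>\<alpha>. THE M. represents_curve M \<alpha>"
proof -
  fix \<alpha> \<beta> :: "real \<Rightarrow> 'a"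
  assume "ac_rel \<alpha> \<beta>"
  then have "\<forall>t\<in>{0..1}. curve_deriv \<beta> t = curve_deriv \<alpha> t"
    using curve_deriv_translate unfolding ac_rel_def by blast
  then have "(LINT t:{0..1}|lebesgue. hom_ext f (curve_deriv \<alpha> t)) =
      (LINT t:{0..1}|lebesgue. hom_ext f (curve_deriv \<beta> t))" for f
    unfolding set_lebesgue_integral_def
    by (intro Bochner_Integration.integral_cong) (auto simp: indicator_def)
  then show "(THE M. represents_curve M \<alpha>) = (THE M. represents_curve M \<beta>)"
    by (simp add: represents_curve_def)
qed

end

theory Submission
  imports Defs "HOL-Probability.Weak_Convergence" "HOL-Probability.Giry_Monad"
begin

text \<open>
  Up to a scalar \<open>m\<close>, the total mass, the task is to find a velocity \<open>g\<close> on \<open>[0,1]\<close> almost all of whose values lie in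
  the unit sphere such that the line spanned by \<open>g t\<close>, for \<open>t\<close> uniformly distributed, has a
  prescribed law on projective space; the curve is then the indefinite integral of \<open>m g\<close>. For a
  merely measurable velocity one would need Lebesgue's differentiation theorem to recover it from
  the curve. The construction below instead yields a velocity that is continuous off a countable
  set, so that the fundamental theorem of calculus at points of continuity is enough.

  The point is to pass through the real line. Projective space admits a Borel map \<open>\<sigma>\<close> to the
  reals whose inverse lifts to a continuous map \<open>h\<close> from the whole real line to the closed unit
  ball: \<open>h (\<sigma> p)\<close> is a unit vector spanning the line \<open>p\<close> (\<open>proj_space_real_coding\<close>). The law of
  \<open>\<sigma>\<close> is the law of its quantile function \<open>I\<close> under Lebesgue measure on \<open>(0,1)\<close>, so
  \<open>g = h \<circ> I\<close> has the required law; and since \<open>I\<close> is monotone, \<open>g\<close> has only countably many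
  discontinuities.

  The map \<open>\<sigma>\<close> comes from a coding of the sphere (\<open>compact_real_coding\<close>): a point is sent to the
  number whose ternary digits record which sets of a countable base contain it. Such a code
  is lower semicontinuous, and so is the larger of the codes of two antipodal points, which is
  what makes it descend to a Borel function on projective space.

  Finally, \<open>\<mu>\<close> has to be the only measure represented by the curve, which holds because finite Borel
  measures on projective space are determined by their integrals of continuous functions
  (\<open>finite_borel_measure_proj_space_eqI\<close>).
\<close>

section \<open>Topology of projective space\<close>

lemma rep_proj_space_sphere: "rep_proj_space p \<in> sphere 0 1"
  using Quotient_rep_reflp[OF Quotient_proj_space, of p] by (simp add: antipodal_rel_def)

lemma norm_rep_proj_space [simp]: "norm (rep_proj_space p) = 1"
  using rep_proj_space_sphere[of p] by simp

lemma sphere_proj_rep: "sphere_proj (rep_proj_space p) = p"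
  using Quotient_abs_rep[OF Quotient_proj_space] .

lemma sphere_proj_uminus: "x \<in> sphere 0 1 \<Longrightarrow> sphere_proj (- x) = sphere_proj x"
  by (simp add: sphere_proj_eq_iff)

lemma continuous_on_proj_space_iff:
  fixes f :: "'a::euclidean_space proj_space \<Rightarrow> 'b::topological_space"
  shows "continuous_on UNIV f \<longleftrightarrow> continuous_on (sphere 0 1) (f \<circ> sphere_proj)"
  using continuous_compose_quotient_map_eq[OF quotient_map_sphere_proj, of euclidean f]
  by simp

lemma continuous_on_sphere_proj: "continuous_on (sphere 0 1) sphere_proj"
  using continuous_on_proj_space_iff[of "\<lambda>p. p"] by (simp add: o_def)

lemma compact_proj_space: "compact (UNIV :: 'a::euclidean_space proj_space set)"
  using compact_continuous_image[OF continuous_on_sphere_proj compact_sphere]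
  by (simp add: sphere_proj_surj)

text \<open>The preimage of the image of \<open>V\<close> is the part of the sphere in the union of \<open>V\<close> and its reflection.\<close>
lemma open_sphere_proj_image:
  assumes "open V"
  shows "open (sphere_proj ` (V \<inter> sphere 0 1))"
proof -
  have "{x \<in> sphere 0 1. sphere_proj x \<in> sphere_proj ` (V \<inter> sphere 0 1)}
      = sphere 0 1 \<inter> (V \<union> uminus ` V)" (is "?L = ?R")
  proof
    show "?L \<subseteq> ?R"
      by (force simp: sphere_proj_eq_iff)
    show "?R \<subseteq> ?L"
    proof
      fix x assume x: "x \<in> ?R"
      then have "x \<in> V \<or> - x \<in> V" by auto
      then show "x \<in> ?L"
        using x sphere_proj_uminus[of x] by (auto intro: rev_image_eqI[of "- x"])
    qed
  qed
  moreover have "open (V \<union> uminus ` V)"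
    using assms by (simp add: open_Un open_negations)
  ultimately show ?thesis
    by (simp add: open_proj_space_def openin_open_Int)
qed

text \<open>
  Away from the origin this is a composition of continuous maps; at the origin, continuity comes
  from the factor \<open>norm v\<close>, because \<open>f\<close> is bounded on the compact projective space.
\<close>
lemma continuous_on_hom_ext:
  fixes f :: "'a::euclidean_space proj_space \<Rightarrow> real"
  assumes "continuous_on UNIV f"
  shows "continuous_on UNIV (hom_ext f)"
proof -
  have "compact (range f)"
    using compact_continuous_image[OF assms compact_proj_space] .
  then obtain B where B: "\<And>p. \<bar>f p\<bar> \<le> B"
    by (metis bounded_iff compact_imp_bounded rangeI real_norm_def)
  have c: "continuous_on (sphere 0 1) (f \<circ> sphere_proj)"
    using assms by (simp add: continuous_on_proj_space_iff)
  have "continuous_on (- {0}) (\<lambda>v::'a. (f \<circ> sphere_proj) (sgn v))"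
    by (rule continuous_on_compose2[OF c]) (auto intro!: continuous_intros simp: norm_sgn split: if_splits)
  then have "continuous_on (- {0}) (hom_ext f)"
    unfolding hom_ext_def o_def by (intro continuous_intros)
  then have 1: "isCont (hom_ext f) v" if "v \<noteq> 0" for v
    using that by (simp add: continuous_on_eq_continuous_at open_Compl)
  have 2: "isCont (hom_ext f) 0"
  proof -
    have "((\<lambda>v::'a. norm v * B) \<longlongrightarrow> 0) (at 0)"
      by (auto intro!: tendsto_eq_intros)
    then have "(hom_ext f \<longlongrightarrow> 0) (at 0)"
      by (rule Lim_null_comparison[rotated])
         (auto simp: hom_ext_def abs_mult intro!: always_eventually mult_left_mono B)
    then show ?thesis by (simp add: isCont_def hom_ext_def)
  qed
  show ?thesis
    using 1 2 by (metis continuous_at_imp_continuous_on)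
qed

text \<open>
  The distance on the sphere to the preimage of the complement of \<open>U\<close> is invariant under
  the antipodal map, hence descends to projective space. This replaces a metric on projective space
  in the approximation of indicator functions.
\<close>
lemma open_proj_space_cozero:
  fixes U :: "'a::euclidean_space proj_space set"
  assumes "open U"
  obtains G :: "'a proj_space \<Rightarrow> real"
  where "continuous_on UNIV G" "\<And>p. 0 \<le> G p" "\<And>p. 0 < G p \<longleftrightarrow> p \<in> U"
proof (cases "U = UNIV")
  \<comment> \<open>The distance to an empty set is \<open>0\<close> by convention, so this case is separate.\<close>
  case True
  then show ?thesis using that[of "\<lambda>_. 1"] by simp
next
  case False
  define K where "K = {x \<in> sphere 0 1. sphere_proj x \<notin> U}"
  define G where "G p = infdist (rep_proj_space p) K" for p
  have K_eq: "K = sphere 0 1 - {x \<in> sphere 0 1. sphere_proj x \<in> U}"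
    by (auto simp: K_def)
  have "closedin (top_of_set (sphere 0 1)) K"
    unfolding K_eq using assms by (intro closedin_diff) (auto simp: open_proj_space_def)
  then have K: "closed K"
    by (rule closedin_closed_trans) simp
  obtain q where "q \<notin> U" using False by auto
  then have "rep_proj_space q \<in> K"
    by (simp add: K_def sphere_proj_rep)
  then have ne: "K \<noteq> {}" by auto
  have mK: "- x \<in> K" if "x \<in> K" for x
    using that sphere_proj_uminus[of x] by (simp add: K_def)
  then have imK: "uminus ` K = K"
    by (metis (no_types, lifting) equalityI image_subset_iff minus_minus rev_image_eqI subsetI)
  have sym: "infdist (- x) K = infdist x K" for x
  proof -
    have "infdist (- x) K = Inf (dist (- x) ` uminus ` K)"
      using ne by (simp add: infdist_notempty imK)
    also have "\<dots> = Inf (dist x ` K)"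
      by (simp add: image_image dist_minus)
    finally show ?thesis using ne by (simp add: infdist_notempty)
  qed
  have "(G \<circ> sphere_proj) x = infdist x K" if "x \<in> sphere 0 1" for x
  proof -
    have "rep_proj_space (sphere_proj x) = x \<or> rep_proj_space (sphere_proj x) = - x"
      using that rep_proj_space_sphere sphere_proj_rep sphere_proj_eq_iff by blast
    then show ?thesis using sym by (auto simp: G_def)
  qed
  then have "continuous_on UNIV G"
    unfolding continuous_on_proj_space_iff
    by (subst continuous_on_cong[OF refl]) (auto intro!: continuous_intros)
  moreover have "0 < G p \<longleftrightarrow> p \<in> U" for p
  proof -
    have "0 < G p \<longleftrightarrow> rep_proj_space p \<notin> K"
      using infdist_nonneg[of "rep_proj_space p" K] in_closed_iff_infdist_zero[OF K ne, of "rep_proj_space p"]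
      by (auto simp: G_def)
    also have "\<dots> \<longleftrightarrow> p \<in> U"
      using rep_proj_space_sphere[of p] by (simp add: K_def sphere_proj_rep)
    finally show ?thesis .
  qed
  ultimately show ?thesis
    using that[of G] by (simp add: G_def infdist_nonneg)
qed

section \<open>Measures on projective space are determined by continuous functions\<close>

text \<open>
  The indicator of an open set is the bounded pointwise limit of the continuous functions
  \<open>min 1 (n G)\<close>, with \<open>G\<close> positive exactly on that set. So both measures agree on open sets, which
  form an intersection-stable generator of the Borel sets.
\<close>
lemma finite_borel_measure_proj_space_eqI:
  fixes M N :: "'a::euclidean_space proj_space measure"
  assumes M: "sets M = sets borel" "finite_measure M"
    and N: "sets N = sets borel" "finite_measure N"
    and eq: "\<And>f :: _ \<Rightarrow> real. continuous_on UNIV f \<Longrightarrow> (LINT p|M. f p) = (LINT p|N. f p)"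
  shows "M = N"
proof (rule measure_eqI_generator_eq[where E = "Collect open" and \<Omega> = UNIV and A = "\<lambda>_. UNIV"])
  fix U :: "'a proj_space set" assume "U \<in> Collect open"
  then have U: "open U" by simp
  obtain G :: "'a proj_space \<Rightarrow> real"
    where G: "continuous_on UNIV G" "\<And>p. 0 \<le> G p" "\<And>p. 0 < G p \<longleftrightarrow> p \<in> U"
    using open_proj_space_cozero[OF U] by metis
  define f where "f n p = min 1 (real n * G p)" for n p
  have cont: "continuous_on UNIV (f n)" for n
    unfolding f_def by (intro continuous_intros G)
  have bd: "\<bar>f n p\<bar> \<le> 1" for n p
    using G(2)[of p] by (simp add: f_def abs_of_nonneg)
  have lim: "(\<lambda>n. f n p) \<longlonglongrightarrow> indicator U p" for p
  proof (cases "p \<in> U")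
    case True
    then have "0 < G p" using G by simp
    then have "filterlim (\<lambda>n. real n * G p) at_top sequentially"
      by (intro filterlim_at_top_mult_tendsto_pos[OF tendsto_const] filterlim_real_sequentially)
    then have "\<forall>\<^sub>F n in sequentially. 1 \<le> real n * G p"
      by (simp add: filterlim_at_top)
    then have "\<forall>\<^sub>F n in sequentially. f n p = 1"
      by eventually_elim (simp add: f_def)
    then show ?thesis using True by (simp add: tendsto_eventually)
  next
    case False
    then have "G p = 0" using G by (metis less_eq_real_def)
    then show ?thesis using False by (simp add: f_def)
  qed
  have conv: "(\<lambda>n. LINT p|L. f n p) \<longlonglongrightarrow> measure L U"
    if L: "sets L = sets borel" "finite_measure L" for L :: "'a proj_space measure"
  proof -
    interpret finite_measure L by fact
    have [measurable]: "f n \<in> borel_measurable L" for n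
      using borel_measurable_continuous_onI[OF cont] measurable_cong_sets[OF L(1) refl] by blast
    have [measurable]: "U \<in> sets L" using U L by simp
    have "(\<lambda>n. LINT p|L. f n p) \<longlonglongrightarrow> (LINT p|L. indicator U p)"
      by (rule integral_dominated_convergence[where w = "\<lambda>_. 1"])
         (auto simp: lim bd)
    then show ?thesis by simp
  qed
  have "measure M U = measure N U"
    using conv[OF M] conv[OF N] eq[OF cont] by (simp add: LIMSEQ_unique)
  then show "emeasure M U = emeasure N U"
    using M N by (simp add: finite_measure.emeasure_eq_measure)
next
  show "emeasure M UNIV \<noteq> \<infinity>"
    using M by (simp add: finite_measure.emeasure_eq_measure)
qed (auto simp: M N borel_def Int_stable_def intro: sets_measure_of)

section \<open>Coding a compact set by real numbers\<close>

text \<open>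
  In base 3 with digits in \<open>[-1,1]\<close> a leading digit of modulus 1 dominates everything after it. Applied to the
  difference of two codes, this shows that close codes have the same initial digits.
\<close>
lemma ternary_series_leading_term:
  fixes d :: "nat \<Rightarrow> real"
  assumes "\<And>j. \<bar>d j\<bar> \<le> 1" and "\<And>j. j < k \<Longrightarrow> d j = 0" and "\<bar>d k\<bar> = 1"
  shows "(1/3)^k / 2 \<le> \<bar>\<Sum>j. (1/3)^j * d j\<bar>"
proof -
  have bd: "norm ((1/3)^j * d j) \<le> (1/3)^j" for j
    using assms(1)[of j] by (simp add: abs_mult mult_left_le)
  have sm: "summable (\<lambda>j. (1/3::real)^j * d j)"
    by (rule summable_comparison_test'[OF summable_geometric[of "1/3::real"] bd]) simp
  have "(\<Sum>j. (1/3)^j * d j) = (\<Sum>j. (1/3)^(j + Suc k) * d (j + Suc k)) + (\<Sum>j<Suc k. (1/3)^j * d j)"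
    by (rule suminf_split_initial_segment[OF sm])
  also have "(\<Sum>j<Suc k. (1/3)^j * d j) = (1/3)^k * d k"
    using assms(2) by simp
  finally have eq: "(\<Sum>j. (1/3)^j * d j) = (\<Sum>j. (1/3)^(j + Suc k) * d (j + Suc k)) + (1/3)^k * d k" .
  have g: "(\<lambda>j. (1/3::real)^(j + Suc k)) sums ((1/3)^k / 2)"
    using sums_mult[OF geometric_sums[of "1/3::real"], of "(1/3)^Suc k"]
    by (simp add: power_add mult.commute)
  have "norm (\<Sum>j. (1/3)^(j + Suc k) * d (j + Suc k)) \<le> (\<Sum>j. (1/3::real)^(j + Suc k))"
    by (rule norm_suminf_le[OF bd sums_summable[OF g]])
  also have "\<dots> = (1/3)^k / 2" using sums_unique[OF g] by simp
  finally have tail: "\<bar>\<Sum>j. (1/3)^(j + Suc k) * d (j + Suc k)\<bar> \<le> (1/3)^k / 2" by simp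
  have "\<bar>(1/3)^k * d k\<bar> = (1/3)^k"
    using assms(3) by (simp add: abs_mult)
  then show ?thesis using tail unfolding eq by linarith
qed

text \<open>
  A point is coded by the ternary number whose \<open>k\<close>-th digit tells whether it lies in the \<open>k\<close>-th set
  of a countable base. As the base sets are open, the code is lower semicontinuous. Decoding is
  uniformly continuous: by compactness, finitely many base sets of small diameter cover \<open>X\<close>, and
  two points with close codes lie in the same ones of them. Hence the decoding map extends to the
  closure of the set of codes, and by Tietze's theorem to the real line with the same bound.
\<close>
lemma compact_real_coding:
  fixes X :: "'a::euclidean_space set"
  assumes X: "compact X" and B: "X \<subseteq> cball 0 B" "0 \<le> B"
  obtains s :: "'a \<Rightarrow> real" and h :: "real \<Rightarrow> 'a"
  where "\<And>c. open {x. c < s x}" "continuous_on UNIV h" "\<And>z. norm (h z) \<le> B"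
    "\<And>x. x \<in> X \<Longrightarrow> h (s x) = x"
proof -
  obtain U :: "nat \<Rightarrow> 'a set" where U: "\<And>n. open (U n)"
    and base: "\<And>S. open S \<Longrightarrow> \<exists>k. S = \<Union>{U n |n. n \<in> k}"
    by (rule univ_second_countable_sequence) (rule that; assumption)
  define s :: "'a \<Rightarrow> real" where "s x = (\<Sum>k. (1/3)^k * indicator (U k) x)" for x
  have sm: "summable (\<lambda>k. (1/3::real)^k * indicator (U k) x)" for x
    by (rule summable_comparison_test'[OF summable_geometric[of "1/3::real"]])
       (auto simp: indicator_def)
  (* If a partial sum at x exceeds c, it still does so on the intersection of the finitely many base
     sets that contribute to it. *)
  have lsc: "open {x. c < s x}" for c
  proof (subst open_subopen, safe)
    fix x assume "c < s x"
    then have "\<forall>\<^sub>F n in sequentially. c < (\<Sum>k<n. (1/3)^k * indicator (U k) x)"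
      using order_tendstoD(1)[OF summable_LIMSEQ[OF sm[of x]]] by (simp add: s_def)
    then obtain n where n: "c < (\<Sum>k<n. (1/3)^k * indicator (U k) x)"
      by (auto simp: eventually_sequentially)
    define T where "T = (\<Inter>k\<in>{k. k < n \<and> x \<in> U k}. U k)"
    have "T \<subseteq> {x. c < s x}"
    proof safe
      fix y assume y: "y \<in> T"
      have "c < (\<Sum>k<n. (1/3)^k * indicator (U k) x)" by (rule n)
      also have "\<dots> \<le> (\<Sum>k<n. (1/3)^k * indicator (U k) y)"
        using y by (intro sum_mono) (auto simp: T_def indicator_def)
      also have "\<dots> \<le> s y"
        unfolding s_def by (rule sum_le_suminf[OF sm]) auto
      finally show "c < s y" .
    qed
    moreover have "open T" unfolding T_def by (intro open_INT) (auto simp: U)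
    moreover have "x \<in> T" by (simp add: T_def)
    ultimately show "\<exists>T. open T \<and> x \<in> T \<and> T \<subseteq> {x. c < s x}" by blast
  qed
  have bits: "x \<in> U k \<longleftrightarrow> y \<in> U k"
    if less: "\<bar>s x - s y\<bar> < (1/3)^N / 2" and "k \<le> N" for x y k N
  proof (rule ccontr)
    assume neq: "\<not> (x \<in> U k \<longleftrightarrow> y \<in> U k)"
    define d where "d j = (indicator (U j) x - indicator (U j) y :: real)" for j
    (* The first digit in which the two codes differ. *)
    define k0 where "k0 = (LEAST k. d k \<noteq> 0)"
    have "d k \<noteq> 0" using neq by (auto simp: d_def indicator_def)
    then have k0: "d k0 \<noteq> 0" "k0 \<le> k" "\<And>j. j < k0 \<Longrightarrow> d j = 0"
      using LeastI[of "\<lambda>k. d k \<noteq> 0" k] Least_le[of "\<lambda>k. d k \<noteq> 0" k] not_less_Least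
      unfolding k0_def by blast+
    have "(1/3::real)^N / 2 \<le> (1/3)^k0 / 2"
      using k0(2) \<open>k \<le> N\<close> by (intro divide_right_mono power_decreasing) auto
    also have "\<dots> \<le> \<bar>\<Sum>j. (1/3)^j * d j\<bar>"
      by (rule ternary_series_leading_term)
         (use k0 in \<open>auto simp: d_def indicator_def split: if_splits\<close>)
    also have "(\<Sum>j. (1/3)^j * d j) = s x - s y"
      unfolding s_def d_def right_diff_distrib by (rule suminf_diff[symmetric, OF sm sm])
    finally show False using less by simp
  qed
  have unif: "\<exists>\<delta>>0. \<forall>x\<in>X. \<forall>y\<in>X. \<bar>s x - s y\<bar> < \<delta> \<longrightarrow> dist x y < \<epsilon>" if \<epsilon>: "0 < \<epsilon>" for \<epsilon>
  proof -
    (* Indices of base sets of diameter at most epsilon. *)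
    define K where "K = {k. \<exists>z. U k \<subseteq> ball z (\<epsilon>/2)}"
    have "x \<in> (\<Union>k\<in>K. U k)" for x
    proof -
      obtain k where k: "ball x (\<epsilon>/2) = \<Union>{U n |n. n \<in> k}"
        using base[OF open_ball[of x "\<epsilon>/2"]] by (rule exE)
      have "x \<in> ball x (\<epsilon>/2)" using \<epsilon> by simp
      then obtain n where "n \<in> k" "x \<in> U n" using k by auto
      moreover have "U n \<subseteq> ball x (\<epsilon>/2)" using k \<open>n \<in> k\<close> by auto
      ultimately show ?thesis unfolding K_def by blast
    qed
    then have "X \<subseteq> (\<Union>k\<in>K. U k)" by blast
    then obtain D where D: "D \<subseteq> K" "finite D" "X \<subseteq> (\<Union>k\<in>D. U k)"
      using compactE_image[OF X, of K U] U by metis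
    obtain N where N: "\<And>k. k \<in> D \<Longrightarrow> k \<le> N"
      using finite_nat_set_iff_bounded_le[of D] D(2) by auto
    have "dist x y < \<epsilon>" if xy: "x \<in> X" "y \<in> X" "\<bar>s x - s y\<bar> < (1/3)^N / 2" for x y
    proof -
      obtain k where k: "k \<in> D" "x \<in> U k" using D(3) xy(1) by auto
      then have "y \<in> U k" using bits[OF xy(3) N[OF k(1)]] by simp
      moreover obtain z where "U k \<subseteq> ball z (\<epsilon>/2)" using k(1) D(1) by (auto simp: K_def)
      ultimately have "dist z x < \<epsilon>/2" "dist z y < \<epsilon>/2" using k(2) by auto
      then show ?thesis using dist_triangle_half_r by blast
    qed
    then show ?thesis by (intro exI[of _ "(1/3)^N / 2"]) auto
  qed
  have inj: "inj_on s X"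
  proof (rule inj_onI, rule ccontr)
    fix x y assume "x \<in> X" "y \<in> X" "s x = s y" "x \<noteq> y"
    then show False using unif[of "dist x y"] by force
  qed
  have "uniformly_continuous_on (s ` X) (inv_into X s)"
    unfolding uniformly_continuous_on_def
  proof (intro allI impI)
    fix \<epsilon> :: real assume "0 < \<epsilon>"
    then obtain \<delta> where "\<delta> > 0" and \<delta>: "\<And>x y. x \<in> X \<Longrightarrow> y \<in> X \<Longrightarrow> \<bar>s x - s y\<bar> < \<delta> \<Longrightarrow> dist x y < \<epsilon>"
      using unif by metis
    then show "\<exists>d>0. \<forall>u\<in>s ` X. \<forall>v\<in>s ` X. dist v u < d \<longrightarrow> dist (inv_into X s v) (inv_into X s u) < \<epsilon>"
      using inj by (intro exI[of _ \<delta>]) (auto simp: dist_real_def inv_into_f_f)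
  qed
  then obtain h0 where h0: "uniformly_continuous_on (closure (s ` X)) h0"
    "\<And>u. u \<in> s ` X \<Longrightarrow> inv_into X s u = h0 u"
    using uniformly_continuous_on_extension_on_closure by metis
  have c0: "continuous_on (closure (s ` X)) h0"
    using h0(1) uniformly_continuous_imp_continuous by blast
  have "h0 ` closure (s ` X) \<subseteq> cball 0 B"
    using B(1) h0(2) inj by (intro image_closure_subset[OF c0]) (auto simp flip: h0(2))
  then have bd: "norm (h0 u) \<le> B" if "u \<in> closure (s ` X)" for u
    using that by auto
  obtain h where h: "continuous_on UNIV h" "\<And>u. u \<in> closure (s ` X) \<Longrightarrow> h u = h0 u"
    "\<And>u. norm (h u) \<le> B"
    using Tietze[OF c0, of UNIV B] bd B(2) by auto
  have "h (s x) = x" if "x \<in> X" for x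
    using that h(2)[of "s x"] h0(2)[of "s x"] inj closure_subset[of "s ` X"] by auto
  then show ?thesis using that lsc h by blast
qed

text \<open>
  A line is coded by the larger of the codes of its two unit vectors. A line has a code greater than
  \<open>c\<close> iff it is the image of a unit vector with code greater than \<open>c\<close>; such vectors form an open subset of the
  sphere and the projection is open, so the coding is lower semicontinuous. Decoding
  returns the unit vector for which the maximum is attained: a Borel choice of a representative of each line.
\<close>
lemma proj_space_real_coding:
  obtains \<sigma> :: "'a::euclidean_space proj_space \<Rightarrow> real" and h :: "real \<Rightarrow> 'a"
  where "\<sigma> \<in> borel_measurable borel" "continuous_on UNIV h" "\<And>z. norm (h z) \<le> 1"
    "\<And>p. h (\<sigma> p) \<in> sphere 0 1" "\<And>p. sphere_proj (h (\<sigma> p)) = p"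
proof -
  obtain s :: "'a \<Rightarrow> real" and h :: "real \<Rightarrow> 'a" where s: "\<And>c. open {x. c < s x}"
    and h: "continuous_on UNIV h" "\<And>z. norm (h z) \<le> 1" "\<And>x. x \<in> sphere 0 1 \<Longrightarrow> h (s x) = x"
    using compact_real_coding[OF compact_sphere[of "0::'a" 1], of 1] by auto
  define \<sigma> where "\<sigma> p = max (s (rep_proj_space p)) (s (- rep_proj_space p))" for p
  have "{p. c < \<sigma> p} = sphere_proj ` ({x. c < s x} \<inter> sphere 0 1)" for c
  proof safe
    fix p assume "c < \<sigma> p"
    then have "c < s (rep_proj_space p) \<or> c < s (- rep_proj_space p)"
      by (auto simp: \<sigma>_def)
    then show "p \<in> sphere_proj ` ({x. c < s x} \<inter> sphere 0 1)"
      using rep_proj_space_sphere[of p] sphere_proj_rep[of p] sphere_proj_uminus[of "rep_proj_space p"]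
      by (metis (mono_tags, lifting) IntI image_eqI mem_Collect_eq mem_sphere_0 norm_minus_cancel)
  next
    fix x assume x: "c < s x" "x \<in> sphere 0 1"
    have "rep_proj_space (sphere_proj x) = x \<or> rep_proj_space (sphere_proj x) = - x"
      using x rep_proj_space_sphere sphere_proj_rep sphere_proj_eq_iff by blast
    then show "c < \<sigma> (sphere_proj x)" using x by (auto simp: \<sigma>_def)
  qed
  then have "{p. c < \<sigma> p} \<in> sets borel" for c
    using open_sphere_proj_image[OF s] by simp
  then have "\<sigma> \<in> borel_measurable borel"
    by (simp add: borel_measurable_iff_greater)
  moreover have "\<exists>x\<in>sphere 0 1. sphere_proj x = p \<and> \<sigma> p = s x" for p
    using rep_proj_space_sphere[of p] sphere_proj_rep[of p] sphere_proj_uminus[of "rep_proj_space p"]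
    unfolding \<sigma>_def max_def by (metis mem_sphere_0 norm_minus_cancel)
  then have "h (\<sigma> p) \<in> sphere 0 1 \<and> sphere_proj (h (\<sigma> p)) = p" for p
    using h(3) by metis
  ultimately show ?thesis using that h by blast
qed

section \<open>Curves with prescribed velocity\<close>

text \<open>
  The indefinite integral of a bounded Borel function is Lipschitz, hence absolutely continuous, and has
  the expected derivative wherever the integrand is continuous.
\<close>
lemma ex_curve_with_velocity:
  fixes g :: "real \<Rightarrow> 'a::euclidean_space"
  assumes g[measurable]: "g \<in> borel_measurable borel" and B: "\<And>t. norm (g t) \<le> B"
    and N: "countable N" and cont: "\<And>t. t \<in> {0<..<1} - N \<Longrightarrow> isCont g t"
  obtains \<alpha> where "abs_continuous_on {0..1} \<alpha>"
    "\<And>t. t \<in> {0<..<1} - N \<Longrightarrow> curve_deriv \<alpha> t = g t"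
proof -
  define \<alpha> where "\<alpha> t = integral {0..t} g" for t
  have int: "g integrable_on {a..b}" for a b
  proof (rule measurable_bounded_by_integrable_imp_integrable[where g = "\<lambda>_. B"])
    show "g \<in> borel_measurable (lebesgue_on {a..b})"
      by (rule measurable_restrict_space1) (rule measurable_completion, simp add: g)
  qed (auto simp: B)
  have lip: "dist (\<alpha> a) (\<alpha> b) \<le> B * (b - a)" if "0 \<le> a" "a \<le> b" for a b
  proof -
    have "\<alpha> b = \<alpha> a + integral {a..b} g"
      unfolding \<alpha>_def using Henstock_Kurzweil_Integration.integral_combine[OF that int] by simp
    then have "dist (\<alpha> a) (\<alpha> b) = norm (integral {a..b} g)" by (simp add: dist_norm)
    also have "\<dots> \<le> integral {a..b} (\<lambda>_. B)"
      by (rule integral_norm_bound_integral[OF int]) (auto simp: B)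
    also have "\<dots> = B * (b - a)" using that by simp
    finally show ?thesis .
  qed
  have B0: "0 \<le> B" using B[of 0] norm_ge_zero order_trans by blast
  have "abs_continuous_on {0..1} \<alpha>"
    unfolding abs_continuous_on_def
  proof (intro allI impI)
    fix \<epsilon> :: real assume \<epsilon>: "0 < \<epsilon>"
    (* The Lipschitz constant B may be 0; dividing by B + 1 avoids a case distinction. *)
    have "(\<Sum>i<n. dist (\<alpha> (a i)) (\<alpha> (b i))) < \<epsilon>"
      if ab: "\<forall>i<n. a i \<le> b i \<and> {a i..b i} \<subseteq> {0..1}" and len: "(\<Sum>i<n. b i - a i) < \<epsilon> / (B + 1)"
      for n :: nat and a b
    proof -
      have "(\<Sum>i<n. dist (\<alpha> (a i)) (\<alpha> (b i))) \<le> (\<Sum>i<n. (B + 1) * (b i - a i))"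
      proof (rule sum_mono)
        fix i assume "i \<in> {..<n}"
        then have "0 \<le> a i" "a i \<le> b i" using ab by auto
        then have "dist (\<alpha> (a i)) (\<alpha> (b i)) \<le> B * (b i - a i)" by (rule lip)
        also have "\<dots> \<le> (B + 1) * (b i - a i)"
          using \<open>a i \<le> b i\<close> by (intro mult_right_mono) auto
        finally show "dist (\<alpha> (a i)) (\<alpha> (b i)) \<le> (B + 1) * (b i - a i)" .
      qed
      also have "\<dots> = (B + 1) * (\<Sum>i<n. b i - a i)" by (simp add: sum_distrib_left)
      also have "\<dots> < \<epsilon>" using len B0 by (simp add: field_simps)
      finally show ?thesis .
    qed
    then show "\<exists>\<delta>>0. \<forall>(n::nat) a b. (\<forall>i<n. a i \<le> b i \<and> {a i..b i} \<subseteq> {0..1}) \<and>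
        disjoint_family_on (\<lambda>i. {a i<..<b i}) {..<n} \<and> (\<Sum>i<n. b i - a i) < \<delta> \<longrightarrow>
        (\<Sum>i<n. dist (\<alpha> (a i)) (\<alpha> (b i))) < \<epsilon>"
      using \<epsilon> B0 by (intro exI[of _ "\<epsilon> / (B + 1)"]) auto
  qed
  moreover have "curve_deriv \<alpha> t = g t" if t: "t \<in> {0<..<1} - N" for t
  proof -
    have "continuous (at t within {0..1} - {}) g"
      using cont[OF t] continuous_at_imp_continuous_at_within by blast
    then have "(\<alpha> has_vector_derivative g t) (at t within {0..1})"
      using integral_has_vector_derivative_continuous_at[OF int[of 0 1], of t "{}"] t
      unfolding \<alpha>_def by auto
    then show ?thesis
      unfolding curve_deriv_def using t by (intro vector_derivative_within_closed_interval) auto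
  qed
  ultimately show ?thesis using that by blast
qed

text \<open>
  The derivative of the curve and \<open>g\<close> differ on a null subset of \<open>[0,1]\<close> only. By completeness of Lebesgue measure
  the derivative inherits measurability from \<open>g\<close>, so the Bochner integrals coincide.
\<close>
lemma integral_curve_deriv:
  fixes g :: "real \<Rightarrow> 'a::euclidean_space" and F :: "'a \<Rightarrow> real"
  assumes g[measurable]: "g \<in> borel_measurable borel" and F[measurable]: "F \<in> borel_measurable borel"
    and N: "countable N" and eq: "\<And>t. t \<in> {0<..<1} - N \<Longrightarrow> curve_deriv \<alpha> t = g t"
  shows "(LINT t:{0..1}|lebesgue. F (curve_deriv \<alpha> t)) = (LINT t|restrict_space lborel {0<..<1}. F (g t))"
proof -
  have "AE t in lborel. t \<notin> N \<union> {0, 1}"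
    by (rule AE_not_in) (use N in \<open>simp add: countable_imp_null_set_lborel\<close>)
  then have "AE t in lebesgue. t \<notin> N \<union> {0, 1}"
    by (rule AE_completion)
  then have ae: "AE t in lebesgue. indicator {0<..<1} t *\<^sub>R F (g t) = indicator {0..1} t *\<^sub>R F (curve_deriv \<alpha> t)"
    by eventually_elim (auto simp: indicator_def eq)
  have m: "(\<lambda>t. indicator {0<..<1} t *\<^sub>R F (g t)) \<in> borel_measurable lborel"
    by measurable
  then have m': "(\<lambda>t. indicator {0<..<1} t *\<^sub>R F (g t)) \<in> borel_measurable lebesgue"
    by (rule measurable_completion)
  have "(LINT t:{0..1}|lebesgue. F (curve_deriv \<alpha> t)) = (LINT t|lebesgue. indicator {0<..<1} t *\<^sub>R F (g t))"
    unfolding set_lebesgue_integral_def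
    by (rule integral_cong_AE[OF borel_measurable_AE[OF m' ae] m']) (use ae in eventually_elim, simp)
  also have "\<dots> = (LINT t|lborel. indicator {0<..<1} t *\<^sub>R F (g t))"
    by (rule integral_completion[OF m])
  also have "\<dots> = (LINT t|restrict_space lborel {0<..<1}. F (g t))"
    by (rule integral_restrict_space[symmetric]) simp
  finally show ?thesis .
qed

section \<open>Realising a measure by a curve\<close>

text \<open>
  With \<open>I\<close> the quantile function of the law of \<open>\<sigma>\<close>, the velocity \<open>m h (I t)\<close> is distributed like
  \<open>m h (\<sigma> p)\<close> for \<open>p\<close> distributed according to \<open>\<nu>\<close>. The latter is \<open>m\<close> times a unit vector spanning
  \<open>p\<close>, so the homogeneous extension of \<open>f\<close> takes the value \<open>m f p\<close> there. As \<open>I\<close> is monotone and \<open>h\<close>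
  is continuous, the velocity has countably many discontinuities.
\<close>
lemma ex_curve_prob_proj_space:
  fixes \<nu> :: "'a::euclidean_space proj_space measure" and m :: real
  assumes sets: "sets \<nu> = sets borel" and "prob_space \<nu>" and m: "0 \<le> m"
  obtains \<alpha> :: "real \<Rightarrow> 'a" where "abs_continuous_on {0..1} \<alpha>"
    "\<And>f. continuous_on UNIV f \<Longrightarrow>
       (LINT t:{0..1}|lebesgue. hom_ext f (curve_deriv \<alpha> t)) = m * (LINT p|\<nu>. f p)"
proof -
  interpret \<nu>: prob_space \<nu> by fact
  obtain \<sigma> :: "'a proj_space \<Rightarrow> real" and h :: "real \<Rightarrow> 'a"
    where \<sigma>: "\<sigma> \<in> borel_measurable borel"
      and h: "continuous_on UNIV h" "\<And>z. norm (h z) \<le> 1"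
        "\<And>p. h (\<sigma> p) \<in> sphere 0 1" "\<And>p. sphere_proj (h (\<sigma> p)) = p"
    using proj_space_real_coding by metis
  have \<sigma>M[measurable]: "\<sigma> \<in> borel_measurable \<nu>"
    using \<sigma> measurable_cong_sets[OF sets refl] by blast
  have hM[measurable]: "h \<in> borel_measurable borel"
    by (rule borel_measurable_continuous_onI[OF h(1)])
  interpret D: cdf_distribution "distr \<nu> borel \<sigma>"
    unfolding cdf_distribution_def using \<nu>.real_distribution_distr[OF \<sigma>M] .
  define g where "g t = (if t \<in> {0<..<1} then m *\<^sub>R h (D.I t) else 0)" for t
  have "(\<lambda>t. m *\<^sub>R h (D.I t)) \<in> borel_measurable (restrict_space borel {0<..<1})"
    by (rule measurable_compose[OF D.measurable_CI]) measurable
  then have "(\<lambda>t. indicator {0<..<1} t *\<^sub>R m *\<^sub>R h (D.I t)) \<in> borel_measurable borel"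
    by (subst (asm) borel_measurable_restrict_space_iff) auto
  also have "(\<lambda>t. indicator {0<..<1} t *\<^sub>R m *\<^sub>R h (D.I t)) = g"
    by (rule ext) (simp add: g_def)
  finally have g: "g \<in> borel_measurable borel" .
  have gB: "norm (g t) \<le> m" for t
    using m h(2) by (auto simp: g_def mult_left_le)
  define N where "N = {t \<in> {0<..<1}. \<not> isCont D.I t}"
  have N: "countable N"
    unfolding N_def by (rule mono_on_ctble_discont_open[OF open_greaterThanLessThan D.mono_I])
  have cont: "isCont g t" if t: "t \<in> {0<..<1} - N" for t
  proof -
    have "isCont D.I t" using t by (auto simp: N_def)
    moreover have "isCont h (D.I t)"
      using h(1) by (simp add: continuous_on_eq_continuous_at)
    ultimately have "isCont (\<lambda>t. h (D.I t)) t"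
      by (rule isCont_o2)
    then have "isCont (\<lambda>t. m *\<^sub>R h (D.I t)) t"
      by (rule isCont_scaleR[OF continuous_const])
    moreover have "\<forall>\<^sub>F u in nhds t. g u = m *\<^sub>R h (D.I u)"
      using t eventually_nhds_in_open[of "{0<..<1}" t] by (auto simp: g_def elim!: eventually_mono)
    ultimately show ?thesis by (subst isCont_cong)
  qed
  obtain \<alpha> where \<alpha>: "abs_continuous_on {0..1} \<alpha>"
    "\<And>t. t \<in> {0<..<1} - N \<Longrightarrow> curve_deriv \<alpha> t = g t"
    using ex_curve_with_velocity[OF g gB N cont] by blast
  have "(LINT t:{0..1}|lebesgue. hom_ext f (curve_deriv \<alpha> t)) = m * (LINT p|\<nu>. f p)"
    if f: "continuous_on UNIV f" for f
  proof -
    have F[measurable]: "hom_ext f \<in> borel_measurable borel"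
      by (rule borel_measurable_continuous_onI[OF continuous_on_hom_ext[OF f]])
    let ?\<Omega> = "restrict_space lborel {0<..<1::real}"
    have I: "D.I \<in> borel_measurable ?\<Omega>"
      using D.measurable_CI by (simp add: measurable_cong_sets[OF sets_restrict_space_cong[OF sets_lborel]])
    have "(LINT t:{0..1}|lebesgue. hom_ext f (curve_deriv \<alpha> t)) = (LINT t|?\<Omega>. hom_ext f (g t))"
      by (rule integral_curve_deriv[OF g F N \<alpha>(2)])
    also have "\<dots> = (LINT t|?\<Omega>. hom_ext f (m *\<^sub>R h (D.I t)))"
      by (intro Bochner_Integration.integral_cong) (auto simp: g_def space_restrict_space)
    also have "\<dots> = (LINT z|distr ?\<Omega> borel D.I. hom_ext f (m *\<^sub>R h z))"
      by (rule integral_distr[symmetric, OF I]) measurable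
    also have "\<dots> = (LINT z|distr \<nu> borel \<sigma>. hom_ext f (m *\<^sub>R h z))"
      by (simp add: D.distr_I_eq_M)
    also have "\<dots> = (LINT p|\<nu>. hom_ext f (m *\<^sub>R h (\<sigma> p)))"
      by (rule integral_distr) measurable
    also have "\<dots> = (LINT p|\<nu>. m * f p)"
      using m h(4) by (simp add: hom_ext_scaleR[OF h(3)])
    finally show ?thesis by simp
  qed
  then show ?thesis using that \<alpha>(1) by blast
qed

text \<open>Every finite measure is its total mass \<open>m\<close> times a probability measure, whose law is realised at speed \<open>m\<close>.\<close>
lemma ex_curve_represents:
  fixes \<mu> :: "'a::euclidean_space proj_space measure"
  assumes sets: "sets \<mu> = sets borel" and fin: "finite_measure \<mu>"
  obtains \<alpha> :: "real \<Rightarrow> 'a" where "abs_continuous_on {0..1} \<alpha>" "represents_curve \<mu> \<alpha>"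
proof -
  interpret finite_measure \<mu> by fact
  have sp: "space \<mu> = UNIV" using sets_eq_imp_space_eq[OF sets] by simp
  define m where "m = measure \<mu> UNIV"
  have "\<exists>\<nu>. sets \<nu> = sets borel \<and> prob_space \<nu> \<and>
      (\<forall>f. continuous_on UNIV f \<longrightarrow> m * (LINT p|\<nu>. f p) = (LINT p|\<mu>. f p))"
  proof (cases "m = 0")
    case True
    then have "UNIV \<in> null_sets \<mu>"
      using sets by (simp add: null_sets_def m_def emeasure_eq_measure)
    then have "(LINT p|\<mu>. f p) = 0" for f :: "'a proj_space \<Rightarrow> real"
      by (intro integral_eq_zero_AE AE_I'[of UNIV]) auto
    (* For the zero measure any probability measure will do; a point mass is one. *)
    then show ?thesis
      using True by (intro exI[of _ "return borel undefined"]) (simp add: prob_space_return)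
  next
    case False
    let ?\<nu> = "density \<mu> (\<lambda>_. ennreal (1 / m))"
    have m: "0 < m" using False by (simp add: m_def zero_less_measure_iff)
    have "UNIV \<in> sets \<mu>" using sets by simp
    then have "emeasure ?\<nu> UNIV = ennreal (1 / m) * ennreal m"
      by (simp add: emeasure_density_const emeasure_eq_measure m_def)
    also have "\<dots> = 1"
      using m by (simp flip: ennreal_mult)
    finally have "prob_space ?\<nu>"
      by (intro prob_spaceI) (simp add: sp)
    moreover have "m * (LINT p|?\<nu>. f p) = (LINT p|\<mu>. f p)" if "continuous_on UNIV f" for f
    proof -
      have "f \<in> borel_measurable \<mu>"
        using borel_measurable_continuous_onI[OF that] measurable_cong_sets[OF sets refl] by blast
      then show ?thesis using m by (subst integral_density) auto
    qed
    ultimately show ?thesis using sets by (intro exI[of _ ?\<nu>]) auto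
  qed
  then obtain \<nu> where \<nu>: "sets \<nu> = sets borel" "prob_space \<nu>"
    "\<And>f. continuous_on UNIV f \<Longrightarrow> m * (LINT p|\<nu>. f p) = (LINT p|\<mu>. f p)"
    by blast
  obtain \<alpha> :: "real \<Rightarrow> 'a" where "abs_continuous_on {0..1} \<alpha>"
    "\<And>f. continuous_on UNIV f \<Longrightarrow>
       (LINT t:{0..1}|lebesgue. hom_ext f (curve_deriv \<alpha> t)) = m * (LINT p|\<nu>. f p)"
    using ex_curve_prob_proj_space[OF \<nu>(1,2), of m] by (auto simp: m_def)
  then show ?thesis
    using that \<nu>(3) sets fin by (simp add: represents_curve_def)
qed

theorem theorem4:
  fixes \<mu> :: "'a::euclidean_space proj_space measure"
  assumes "sets \<mu> = sets borel" and "finite_measure \<mu>"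
  shows "\<exists>\<alpha> :: 'a ac_curve. curve_measure \<alpha> = \<mu>"
proof -
  obtain \<alpha> :: "real \<Rightarrow> 'a" where ac: "abs_continuous_on {0..1} \<alpha>" and rep: "represents_curve \<mu> \<alpha>"
    using ex_curve_represents[OF assms] by blast
  have "ac_rel \<alpha> \<alpha>"
    using ac by (auto simp: ac_rel_def intro: exI[of _ 0])
  then have "curve_measure (abs_ac_curve \<alpha>) = (THE M. represents_curve M \<alpha>)"
    by (rule curve_measure.abs_eq[unfolded eq_onp_def])
  also have "\<dots> = \<mu>"
    using rep by (intro the_equality)
      (auto simp: represents_curve_def intro!: finite_borel_measure_proj_space_eqI)
  finally show ?thesis by blast
qed

end
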